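(* Let $(X,\mathcal A)$ be a measurable space, $\mu$ a monotone measure on $\mathcal A$, and $A\in\mathcal A$. Suppose that $H\colon[0,\infty)\to[0,\infty)$ is a convex function which attains its infimum at a point $a$. Then the sharp inequality $$\mathrm{Su}(H(f);A,\mu)\ \ge\ H(p)\wedge p$$ holds for any $\mathcal A$-measurable $f\colon X\to[0,\infty)$ such that $p:=\mathrm{Su}(f;A,\mu)\in[a,\infty)$.
   Context: A monotone measure on $\mathcal A$ is a set function $\mu\colon\mathcal A\to[0,\infty]$ with $\mu(\emptyset)=0$ and $\mu(B)\le\mu(C)$ whenever $B\subset C$. Notation: $a\wedge b=\min(a,b)$; $H(f)=H\circ f$. Sugeno integral: for measurable $g\colon X\to[0,\infty]$, $\mathrm{Su}(g;A,\mu)=\sup_{t\ge0}\{t\wedge\mu(A\cap\{g\ge t\})\}$, where $\{g\ge t\}=\{x\in X:g(x)\ge t\}$. *)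

theory Defs
  imports "HOL-Analysis.Analysis"
begin

text \<open>Throughout, a value of type \<^typ>\<open>'a measure\<close> only serves as a measurable space
  (\<^term>\<open>space M\<close>, \<^term>\<open>sets M\<close>). Its built-in countably additive measure is never used;
  the monotone measure is a separate set function, constrained on \<^term>\<open>sets M\<close> only.\<close>

definition monotone_measure :: "'a measure \<Rightarrow> ('a set \<Rightarrow> ennreal) \<Rightarrow> bool" where
  "monotone_measure M \<mu> \<longleftrightarrow>
     \<mu> {} = 0 \<and> (\<forall>B\<in>sets M. \<forall>C\<in>sets M. B \<subseteq> C \<longrightarrow> \<mu> B \<le> \<mu> C)"

text \<open>The levels \<open>t\<close> range over the finite numbers in \<open>[0,\<infinity>)\<close>. Admitting \<open>t = \<infinity>\<close> would not
  change the supremum, as \<open>\<mu> (A \<inter> {g = \<infinity>})\<close> is the supremum of its truncations at finite \<open>t\<close>.\<close>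

definition sugeno :: "'a measure \<Rightarrow> ('a set \<Rightarrow> ennreal) \<Rightarrow> 'a set \<Rightarrow> ('a \<Rightarrow> ennreal) \<Rightarrow> ennreal" where
  "sugeno M \<mu> A g =
     (SUP t\<in>{0::real..}. min (ennreal t) (\<mu> (A \<inter> {x \<in> space M. g x \<ge> ennreal t})))"

end

theory Submission
  imports Defs
begin

text \<open>If \<open>p > a\<close>, the level sets of \<open>f\<close> at heights \<open>t < p\<close> have measure at least \<open>t\<close>, and they lie in
  the level sets of \<open>H \<circ> f\<close> at heights \<open>H t\<close> because a convex function increases to the right of its
  minimum point. Hence \<open>min (H t) t\<close> is a lower bound for every \<open>t \<in> (a, p)\<close>, and \<open>t\<close> tends to \<open>p\<close> from the left by
  continuity of \<open>H\<close> in the interior. Continuity may fail at \<open>0\<close>, but if \<open>p = a\<close> the level set of \<open>H \<circ> f\<close>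
  at height \<open>H a\<close> is everything. Equality is attained by a constant function and a measure with values in
  \<open>{0, p}\<close>.\<close>

lemma le_sugeno:
  "0 \<le> t \<Longrightarrow> min (ennreal t) (\<mu> (A \<inter> {x \<in> space M. ennreal t \<le> g x})) \<le> sugeno M \<mu> A g"
  unfolding sugeno_def by (rule SUP_upper) auto

text \<open>Every level set is cut down to \<open>A\<close>, so monotonicity bounds each term of the
  supremum by \<open>\<mu> A\<close>. This handles the boundary case \<open>p = a\<close>.\<close>

lemma sugeno_le_measure:
  assumes "monotone_measure M \<mu>" and "A \<in> sets M" and "g \<in> borel_measurable M"
  shows "sugeno M \<mu> A g \<le> \<mu> A"
  unfolding sugeno_def
proof (rule SUP_least)
  fix t :: real
  have "A \<inter> {x \<in> space M. ennreal t \<le> g x} \<in> sets M"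
    using assms by measurable
  then have "\<mu> (A \<inter> {x \<in> space M. ennreal t \<le> g x}) \<le> \<mu> A"
    using assms unfolding monotone_measure_def by auto
  then show "min (ennreal t) (\<mu> (A \<inter> {x \<in> space M. ennreal t \<le> g x})) \<le> \<mu> A"
    by (simp add: min.coboundedI2)
qed

text \<open>Some term of the supremum, at a level \<open>s\<close>, exceeds \<open>t\<close>; hence
  \<open>s\<close> lies above \<open>t\<close>, and the level set at \<open>s\<close> is contained
  in the one at \<open>t\<close>.\<close>

lemma less_sugeno_imp_le_measure:
  assumes "monotone_measure M \<mu>" and "A \<in> sets M" and "g \<in> borel_measurable M"
    and "ennreal t < sugeno M \<mu> A g"
  shows "ennreal t \<le> \<mu> (A \<inter> {x \<in> space M. ennreal t \<le> g x})"
proof -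
  obtain s where s: "ennreal t < ennreal s"
    "ennreal t < \<mu> (A \<inter> {x \<in> space M. ennreal s \<le> g x})"
    using assms(4) unfolding sugeno_def by (auto simp: less_SUP_iff)
  have "A \<inter> {x \<in> space M. ennreal r \<le> g x} \<in> sets M" for r
    using assms(2,3) by measurable
  moreover have "A \<inter> {x \<in> space M. ennreal s \<le> g x} \<subseteq> A \<inter> {x \<in> space M. ennreal t \<le> g x}"
    using s(1) by auto
  ultimately have "\<mu> (A \<inter> {x \<in> space M. ennreal s \<le> g x}) \<le> \<mu> (A \<inter> {x \<in> space M. ennreal t \<le> g x})"
    using assms(1) unfolding monotone_measure_def by blast
  with s(2) show ?thesis by simp
qed

text \<open>The level sets within \<open>A\<close> are \<open>A\<close> itself up to height
  \<open>c\<close> and empty above it. This evaluates both integrals in the equality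
  example.\<close>

lemma sugeno_const:
  assumes "\<mu> {} = 0" and "A \<subseteq> space M" and "0 \<le> c"
  shows "sugeno M \<mu> A (\<lambda>x. ennreal c) = min (ennreal c) (\<mu> A)"
proof (rule antisym)
  have A: "A \<inter> space M = A" using assms(2) by auto
  show "sugeno M \<mu> A (\<lambda>x. ennreal c) \<le> min (ennreal c) (\<mu> A)"
    unfolding sugeno_def
  proof (rule SUP_least)
    fix t :: real
    show "min (ennreal t) (\<mu> (A \<inter> {x \<in> space M. ennreal t \<le> ennreal c})) \<le> min (ennreal c) (\<mu> A)"
      by (cases "ennreal t \<le> ennreal c") (auto simp: A assms(1) min.coboundedI1)
  qed
  show "min (ennreal c) (\<mu> A) \<le> sugeno M \<mu> A (\<lambda>x. ennreal c)"
    using le_sugeno[OF assms(3), of \<mu> A M "\<lambda>x. ennreal c"] by (simp add: A)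
qed

lemma convex_on_sublevel_convex:
  fixes H :: "'a::real_vector \<Rightarrow> real"
  assumes "convex_on S H"
  shows "convex {x \<in> S. H x < c}"
proof (rule convexI)
  fix x y and u v :: real
  assume x: "x \<in> {x \<in> S. H x < c}" and y: "y \<in> {x \<in> S. H x < c}"
    and uv: "0 \<le> u" "0 \<le> v" "u + v = 1"
  have "H (u *\<^sub>R x + v *\<^sub>R y) \<le> u * H x + v * H y"
    using assms x y uv unfolding convex_on_def by auto
  also have "\<dots> < c"
    using convex_bound_lt[of "H x" c "H y" u v] x y uv by simp
  finally show "u *\<^sub>R x + v *\<^sub>R y \<in> {x \<in> S. H x < c}"
    using convexD[OF convex_on_imp_convex[OF assms]] x y uv by auto
qed

text \<open>Since \<open>H\<close> may be discontinuous at an endpoint of \<open>S\<close>,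
  measurability is not drawn from continuity: strict sublevel sets of a convex function are convex,
  and on the line these are intervals, hence Borel.\<close>

lemma convex_on_borel_measurable_comp:
  fixes H :: "real \<Rightarrow> real"
  assumes "convex_on S H" and "f \<in> borel_measurable M" and "\<And>x. x \<in> space M \<Longrightarrow> f x \<in> S"
  shows "(\<lambda>x. H (f x)) \<in> borel_measurable M"
  unfolding borel_measurable_iff_less
proof
  fix c
  have "{y \<in> S. H y < c} \<in> sets borel"
    using convex_on_sublevel_convex[OF assms(1)]
    by (intro real_interval_borel_measurable) (simp add: is_interval_convex_1)
  then have "f -` {y \<in> S. H y < c} \<inter> space M \<in> sets M"
    using assms(2) by (rule measurable_sets[rotated])
  moreover have "f -` {y \<in> S. H y < c} \<inter> space M = {x \<in> space M. H (f x) < c}"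
    using assms(3) by auto
  ultimately show "{x \<in> space M. H (f x) < c} \<in> sets M" by simp
qed

lemma sugeno_convex_comp_ge:
  fixes H :: "real \<Rightarrow> real"
  assumes mono: "monotone_measure M \<mu>" and A: "A \<in> sets M"
    and nonneg: "\<And>x. 0 \<le> x \<Longrightarrow> 0 \<le> H x" and conv: "convex_on {0..} H"
    and a: "0 \<le> a" and min: "\<And>x. 0 \<le> x \<Longrightarrow> H a \<le> H x"
    and f: "f \<in> borel_measurable M" and f0: "\<And>x. x \<in> space M \<Longrightarrow> 0 \<le> f x"
    and p: "a \<le> p" "sugeno M \<mu> A (\<lambda>x. ennreal (f x)) = ennreal p"
  shows "min (ennreal (H p)) (ennreal p) \<le> sugeno M \<mu> A (\<lambda>x. ennreal (H (f x)))"
proof (cases "p = a")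
  case True
  have "A \<inter> {x \<in> space M. ennreal (H a) \<le> ennreal (H (f x))} = A"
    using min f0 sets.sets_into_space[OF A] by (auto intro!: ennreal_leI)
  then have "min (ennreal (H a)) (\<mu> A) \<le> sugeno M \<mu> A (\<lambda>x. ennreal (H (f x)))"
    using le_sugeno[OF nonneg[OF a], of \<mu> A M "\<lambda>x. ennreal (H (f x))"] by simp
  moreover have "ennreal p \<le> \<mu> A"
    using sugeno_le_measure[OF mono A, of "\<lambda>x. ennreal (f x)"] f p by simp
  ultimately show ?thesis
    using True by (meson min.mono order.refl order.trans)
next
  case False
  with p have ap: "a < p" by simp
  have Hf: "(\<lambda>x. H (f x)) \<in> borel_measurable M"
    using convex_on_borel_measurable_comp[OF conv f] f0 by simp
  have level: "min (ennreal (H t)) (ennreal t) \<le> sugeno M \<mu> A (\<lambda>x. ennreal (H (f x)))"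
    if t: "a < t" "t < p" for t
  proof -
    have "ennreal t \<le> \<mu> (A \<inter> {x \<in> space M. ennreal t \<le> ennreal (f x)})"
      using t a p f by (intro less_sugeno_imp_le_measure mono A) (auto simp: ennreal_less_iff)
    also have "\<dots> \<le> \<mu> (A \<inter> {x \<in> space M. ennreal (H t) \<le> ennreal (H (f x))})"
    proof -
      have "A \<inter> {x \<in> space M. ennreal t \<le> ennreal (f x)} \<in> sets M"
        "A \<inter> {x \<in> space M. ennreal (H t) \<le> ennreal (H (f x))} \<in> sets M"
        using A f Hf by measurable
      moreover have "H t \<le> H (f x)" if x: "x \<in> space M" "ennreal t \<le> ennreal (f x)" for x
      proof -
        have "t \<le> f x"
          using x f0 by (simp add: ennreal_le_iff)
        moreover have "convex_on {a..f x} H"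
          using a by (intro convex_on_subset[OF conv]) auto
        \<comment> \<open>As \<open>t\<close> lies between \<open>a\<close> and \<open>f x\<close>,
          convexity bounds \<open>H t\<close> by the larger endpoint value, which is
          \<open>H (f x)\<close> because \<open>H a\<close> is the minimum.\<close>
        ultimately have "H t \<le> max (H a) (H (f x))"
          using t by (intro convex_on_le_max) auto
        then show ?thesis
          using min f0 x by (simp add: max_absorb2)
      qed
      then have "A \<inter> {x \<in> space M. ennreal t \<le> ennreal (f x)}
          \<subseteq> A \<inter> {x \<in> space M. ennreal (H t) \<le> ennreal (H (f x))}"
        by (auto intro: ennreal_leI)
      ultimately show ?thesis
        using mono unfolding monotone_measure_def by blast
    qed
    \<comment> \<open>Replacing \<open>t\<close> by the larger measure turns the minimum into the
      term of level \<open>H t\<close> in the supremum for \<open>H \<circ> f\<close>.\<close>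
    finally have "min (ennreal (H t)) (ennreal t)
        \<le> min (ennreal (H t)) (\<mu> (A \<inter> {x \<in> space M. ennreal (H t) \<le> ennreal (H (f x))}))"
      by (rule min.mono[OF order.refl])
    also have "\<dots> \<le> sugeno M \<mu> A (\<lambda>x. ennreal (H (f x)))"
      using t a by (intro le_sugeno nonneg) auto
    finally show ?thesis .
  qed
  \<comment> \<open>Here \<open>0 \<le> a < p\<close>, so \<open>p\<close> is an interior point of
    the domain and the bound on \<open>(a, p)\<close> passes to the limit from the left.\<close>
  have "continuous_on {0<..} H"
    by (intro convex_on_continuous convex_on_subset[OF conv]) auto
  then have "isCont H p"
    using ap a by (intro continuous_on_interior[of "{0<..}"]) (auto simp: interior_open)
  then have "(H \<longlongrightarrow> H p) (at_left p)"
    by (auto simp: isCont_def intro: filterlim_mono at_le)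
  then have "((\<lambda>t. min (ennreal (H t)) (ennreal t)) \<longlongrightarrow> min (ennreal (H p)) (ennreal p)) (at_left p)"
    by (intro tendsto_min tendsto_ennrealI tendsto_ident_at)
  moreover have "\<forall>\<^sub>F t in at_left p. min (ennreal (H t)) (ennreal t) \<le> sugeno M \<mu> A (\<lambda>x. ennreal (H (f x)))"
    using level unfolding eventually_at_left[OF ap] by (auto intro!: exI[of _ a] ap)
  ultimately show ?thesis
    by (rule tendsto_upperbound) simp
qed

theorem corollary2p2:
  fixes M :: "'a measure" and \<mu> :: "'a set \<Rightarrow> ennreal" and A :: "'a set"
    and H :: "real \<Rightarrow> real" and a :: real
  assumes "monotone_measure M \<mu>"
    and "A \<in> sets M"
    and "\<And>x. 0 \<le> x \<Longrightarrow> 0 \<le> H x"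
    and "convex_on {0..} H"
    and "0 \<le> a"
    and "\<And>x. 0 \<le> x \<Longrightarrow> H a \<le> H x"
  shows
    "(\<forall>f p. f \<in> borel_measurable M \<and> (\<forall>x\<in>space M. 0 \<le> f x) \<and>
        a \<le> p \<and> sugeno M \<mu> A (\<lambda>x. ennreal (f x)) = ennreal p \<longrightarrow>
        sugeno M \<mu> A (\<lambda>x. ennreal (H (f x))) \<ge> min (ennreal (H p)) (ennreal p))
     \<and>
     (A \<noteq> {} \<longrightarrow>
       (\<forall>p\<ge>a. \<exists>\<nu> f. monotone_measure M \<nu> \<and>
          f \<in> borel_measurable M \<and> (\<forall>x\<in>space M. 0 \<le> f x) \<and>
          sugeno M \<nu> A (\<lambda>x. ennreal (f x)) = ennreal p \<and>
          sugeno M \<nu> A (\<lambda>x. ennreal (H (f x))) = min (ennreal (H p)) (ennreal p)))"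
proof (intro conjI allI impI)
  fix f p
  assume "f \<in> borel_measurable M \<and> (\<forall>x\<in>space M. 0 \<le> f x) \<and>
    a \<le> p \<and> sugeno M \<mu> A (\<lambda>x. ennreal (f x)) = ennreal p"
  then show "min (ennreal (H p)) (ennreal p) \<le> sugeno M \<mu> A (\<lambda>x. ennreal (H (f x)))"
    using assms by (intro sugeno_convex_comp_ge[of M \<mu> A H a f p]) auto
next
  fix p
  assume "A \<noteq> {}" and p: "a \<le> p"
  \<comment> \<open>As \<open>A\<close> is nonempty, \<open>\<nu> A = p\<close>, so a constant
    \<open>c \<ge> 0\<close> has integral \<open>min c p\<close>. For the constant function
    \<open>f = p\<close>, the choices \<open>c = p\<close> and \<open>c = H p\<close> give the two
    required values.\<close>
  define \<nu> :: "'a set \<Rightarrow> ennreal" where "\<nu> = (\<lambda>B. if B \<inter> A = {} then 0 else ennreal p)"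
  have "0 \<le> p" using p assms(5) by simp
  have "monotone_measure M \<nu>"
    unfolding monotone_measure_def \<nu>_def by auto
  moreover have "sugeno M \<nu> A (\<lambda>x. ennreal c) = min (ennreal c) (ennreal p)" if "0 \<le> c" for c
    using sugeno_const[of \<nu> A M c] that sets.sets_into_space[OF assms(2)] \<open>A \<noteq> {}\<close>
    by (simp add: \<nu>_def)
  ultimately show "\<exists>\<nu> f. monotone_measure M \<nu> \<and> f \<in> borel_measurable M \<and>
      (\<forall>x\<in>space M. 0 \<le> f x) \<and> sugeno M \<nu> A (\<lambda>x. ennreal (f x)) = ennreal p \<and>
      sugeno M \<nu> A (\<lambda>x. ennreal (H (f x))) = min (ennreal (H p)) (ennreal p)"
    using \<open>0 \<le> p\<close> assms(3) by (intro exI[of _ \<nu>] exI[of _ "\<lambda>_. p"]) simp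
qed

end
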